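(* Let $S$ be a semigroup, let $a_1,a_2,b,c\in S$, and suppose that $a_1a_2$ is $(b,c)$-invertible with $(b,c)$-inverse $x$. (1) If $\mu,\nu\in S^1$ satisfy $(a_1a_2)b\in b\mu S$ and $c(a_1a_2)\in S\nu c$, then $a_2a_1$ is $(a_2b\mu,\nu ca_1)$-invertible, and its $(a_2b\mu,\nu ca_1)$-inverse is $a_2x^2a_1$. (2) In particular, if $x(a_1a_2)=(a_1a_2)x$ and $b=c=d$ for some $d\in S$, then $a_2a_1$ is $(a_2da_1,a_2da_1)$-invertible, and its $(a_2da_1,a_2da_1)$-inverse is $a_2x^2a_1$.
   Context: For $a,b,c\in S$, an element $x\in S$ is a $(b,c)$-inverse of $a$ if $xab=b$, $cax=c$, $x\in bSx$, and $x\in xSc$ (equivalently $xab=b$, $cax=c$, $x\in bS$, $x\in Sc$); such $x$ is unique when it exists, and $a$ is then called $(b,c)$-invertible. Here $uS=\{us:s\in S\}$ and $Su=\{su:s\in S\}$. $S^1$ denotes the monoid equal to $S$ if $S$ has an identity element and to $S\cup\{1\}$ (with an identity $1$ adjoined) otherwise. *)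

theory Defs
  imports Main
begin

text \<open>The semigroup \<open>S\<close> is the whole type \<open>'a\<close> of class \<^class>\<open>semigroup_mult\<close>.\<close>

definition is_bc_inverse :: "'a::semigroup_mult \<Rightarrow> 'a \<Rightarrow> 'a \<Rightarrow> 'a \<Rightarrow> bool" where
  "is_bc_inverse a b c x \<longleftrightarrow>
     x * a * b = b \<and> c * a * x = c \<and> x \<in> {b * s * x | s. True} \<and> x \<in> {x * s * c | s. True}"

definition bc_invertible :: "'a::semigroup_mult \<Rightarrow> 'a \<Rightarrow> 'a \<Rightarrow> bool" where
  "bc_invertible a b c \<longleftrightarrow> (\<exists>x. is_bc_inverse a b c x)"

text \<open>By uniqueness, \<open>is_bc_inverse a b c x\<close> may be read as ``the \<open>(b,c)\<close>-inverse of \<open>a\<close> is \<open>x\<close>''.\<close>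

lemma is_bc_inverse_unique:
  assumes "is_bc_inverse a b c x" and "is_bc_inverse a b c y"
  shows "x = y"
proof -
  obtain s where s: "x = b * s * x" using assms(1) by (auto simp: is_bc_inverse_def)
  obtain t where t: "y = y * t * c" using assms(2) by (auto simp: is_bc_inverse_def)
  have "y * a * b = b" and "c * a * x = c"
    using assms by (auto simp: is_bc_inverse_def)
  then have "y * a * x = x" and "y * a * x = y"
    using s t by (metis mult.assoc)+
  then show ?thesis by simp
qed

text \<open>
  The monoid \<open>S\<^sup>1\<close>: \<open>Some s\<close> stands for \<open>s \<in> S\<close> and \<open>None\<close> for the adjoined identity, which
  belongs to \<open>S\<^sup>1\<close> only if \<open>S\<close> itself has no identity element. Since \<open>S\<close> is an ideal of \<open>S\<^sup>1\<close>,
  the products \<open>s\<mu>\<close> and \<open>\<nu>s\<close> with \<open>s \<in> S\<close> and \<open>\<mu>, \<nu> \<in> S\<^sup>1\<close> are taken directly in \<open>S\<close>.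
\<close>

definition S1 :: "'a::semigroup_mult option set" where
  "S1 = (if \<exists>e::'a. \<forall>s. e * s = s \<and> s * e = s then range Some else UNIV)"

fun mult_S1_right :: "'a::semigroup_mult \<Rightarrow> 'a option \<Rightarrow> 'a"  (infixl "\<cdot>\<^sub>r" 70) where
  "s \<cdot>\<^sub>r None = s"
| "s \<cdot>\<^sub>r Some m = s * m"

fun mult_S1_left :: "'a::semigroup_mult option \<Rightarrow> 'a \<Rightarrow> 'a"  (infixl "\<cdot>\<^sub>l" 70) where
  "None \<cdot>\<^sub>l s = s"
| "Some n \<cdot>\<^sub>l s = n * s"

end

theory Submission
  imports Defs
begin

text \<open>
  Write \<open>a = a1 * a2\<close>. The two range conditions together are much stronger than each of them
  alone: they force \<open>x\<close> to commute with \<open>a\<close>. Indeed \<open>x * a\<close> is an idempotent acting as a left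
  identity on \<open>b S\<close>, \<open>a * x\<close> is one acting as a right identity on \<open>S c\<close>, and the conditions
  place \<open>a * x\<close> in \<open>b S\<close> and \<open>x * a\<close> in \<open>S c\<close>; hence both equal \<open>(x * a) * (a * x)\<close>
  (lemma \<open>bc_inverse_commutes\<close>). So \<open>x\<close> is an outer inverse of \<open>a\<close> commuting with \<open>a\<close>, and the
  passage from \<open>a1 * a2\<close> to \<open>a2 * a1\<close> is the one in Cline's formula for the Drazin inverse:
  \<open>a2 * x\<^sup>2 * a1\<close> is the inverse of \<open>a2 * a1\<close> (lemma \<open>bc_inverse_swap\<close>).

  The elements \<open>\<mu>\<close> and \<open>\<nu>\<close> enter only through \<open>\<beta> = b\<mu>\<close> and \<open>\<gamma> = \<nu>c\<close>, of which one needs,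
  besides the range conditions, that \<open>x * a\<close> fixes \<open>\<beta>\<close> from the left and \<open>a * x\<close> fixes \<open>\<gamma>\<close> from the right.
  The commuting case \<open>b = c = d\<close> is the instance \<open>\<mu> = a1\<close>, \<open>\<nu> = a2\<close>.
\<close>

lemma bc_inverse_outer:
  assumes "is_bc_inverse a b c x"
  shows "x * a * x = x"
proof -
  obtain s where s: "x = b * s * x"
    using assms by (auto simp: is_bc_inverse_def)
  have "x * a * x = x * a * b * s * x"
    by (subst (2) s) (simp add: mult.assoc)
  also have "\<dots> = b * s * x"
    using assms by (simp add: is_bc_inverse_def)
  finally show ?thesis
    using s by simp
qed

text \<open>
  As \<open>x\<close> lies in \<open>b S\<close>, a left divisor of \<open>a * b\<close> is also one of \<open>a * x\<close>; as \<open>x\<close> lies in \<open>S c\<close>,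
  a right divisor of \<open>c * a\<close> is also one of \<open>x * a\<close>.
\<close>

lemma bc_inverse_range_left:
  assumes "is_bc_inverse a b c x" and "a * b = \<beta> * p"
  shows "\<exists>u. a * x = \<beta> * u"
proof -
  obtain s where s: "x = b * s * x" using assms(1) by (auto simp: is_bc_inverse_def)
  have "a * x = a * b * (s * x)"
    by (subst s) (simp add: mult.assoc)
  then show ?thesis
    using assms(2) by (auto simp: mult.assoc)
qed

lemma bc_inverse_range_right:
  assumes "is_bc_inverse a b c x" and "c * a = q * \<gamma>"
  shows "\<exists>v. x * a = v * \<gamma>"
proof -
  obtain t where t: "x = x * t * c" using assms(1) by (auto simp: is_bc_inverse_def)
  have "x * a = x * t * (c * a)"
    by (subst t) (simp add: mult.assoc)
  also have "\<dots> = x * t * q * \<gamma>"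
    using assms(2) by (simp add: mult.assoc)
  finally show ?thesis ..
qed

text \<open>
  Both products equal \<open>(x * a) * (a * x)\<close>: the left factor acts trivially on \<open>a * x \<in> \<beta> S\<close>, the
  right one on \<open>x * a \<in> S \<gamma>\<close>.
\<close>

lemma bc_inverse_commutes:
  fixes a b c x :: "'a::semigroup_mult"
  assumes inv: "is_bc_inverse a b c x"
    and \<beta>: "x * a * \<beta> = \<beta>" and \<gamma>: "\<gamma> * a * x = \<gamma>"
    and p: "a * b = \<beta> * p" and q: "c * a = q * \<gamma>"
  shows "a * x = x * a"
proof -
  obtain u where u: "a * x = \<beta> * u"
    using bc_inverse_range_left[OF inv p] ..
  obtain v where v: "x * a = v * \<gamma>"
    using bc_inverse_range_right[OF inv q] ..
  have "x * a * (a * x) = x * a * \<beta> * u"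
    by (simp add: u mult.assoc)
  also have "\<dots> = a * x"
    by (simp only: \<beta> u)
  finally have "x * a * (a * x) = a * x" .
  moreover have "x * a * (a * x) = v * (\<gamma> * a * x)"
    by (simp only: v mult.assoc)
  then have "x * a * (a * x) = x * a"
    by (simp only: \<gamma> v)
  ultimately show ?thesis by simp
qed

text \<open>
  Once \<open>x\<close> commutes with \<open>a = a1 * a2\<close>, the product \<open>x * x * a * a\<close> is \<open>(x * a) * (x * a)\<close>, which
  fixes \<open>\<beta>\<close> and \<open>\<gamma>\<close>; these are the two absorption laws. Commutation also yields the range conditions: since \<open>x = a * x * x\<close> and
  \<open>a * x \<in> \<beta> S\<close>, also \<open>x \<in> \<beta> S\<close>, although \<open>\<beta> S\<close> is only assumed to contain \<open>a * b\<close> and not \<open>b\<close>;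
  symmetrically \<open>x \<in> S \<gamma>\<close>.
\<close>

lemma bc_inverse_swap:
  fixes a1 a2 b c x :: "'a::semigroup_mult"
  assumes inv: "is_bc_inverse (a1 * a2) b c x"
    and \<beta>: "x * (a1 * a2) * \<beta> = \<beta>" and \<gamma>: "\<gamma> * (a1 * a2) * x = \<gamma>"
    and p: "(a1 * a2) * b = \<beta> * p" and q: "c * (a1 * a2) = q * \<gamma>"
  shows "is_bc_inverse (a2 * a1) (a2 * \<beta>) (\<gamma> * a1) (a2 * (x * x) * a1)"
proof -
  define a where "a = a1 * a2"
  have a_word: "a1 * (a2 * z) = a * z" for z
    by (simp add: a_def mult.assoc)
  have comm: "a * x = x * a"
    unfolding a_def by (rule bc_inverse_commutes[OF inv \<beta> \<gamma> p q])
  have comm_left: "a * (x * z) = x * (a * z)" for z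
    by (simp only: mult.assoc[symmetric] comm)
  note sort_word = mult.assoc comm comm_left
  have outer: "x * a * x = x"
    unfolding a_def by (rule bc_inverse_outer[OF inv])
  obtain u where u: "a * x = \<beta> * u"
    using bc_inverse_range_left[OF inv p] unfolding a_def ..
  obtain v where v: "x * a = v * \<gamma>"
    using bc_inverse_range_right[OF inv q] unfolding a_def ..
  have x\<beta>: "x = \<beta> * u * x"
    using outer by (simp only: u[symmetric] comm)
  have x\<gamma>: "x = x * v * \<gamma>"
    using outer by (simp only: mult.assoc v[symmetric] comm)
  have "x * (x * (a * (a * \<beta>))) = x * a * (x * a * \<beta>)"
    by (simp add: sort_word)
  also have "\<dots> = \<beta>"
    using \<beta> by (simp only: a_def)
  finally have absorb_left: "a2 * (x * x) * a1 * (a2 * a1) * (a2 * \<beta>) = a2 * \<beta>"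
    by (simp add: mult.assoc a_word)
  have "\<gamma> * (a * (a * (x * (x * a1)))) = \<gamma> * a * x * a * x * a1"
    by (simp add: sort_word)
  also have "\<dots> = \<gamma> * a1"
    using \<gamma> by (simp only: a_def)
  finally have absorb_right: "\<gamma> * a1 * (a2 * a1) * (a2 * (x * x) * a1) = \<gamma> * a1"
    by (simp add: mult.assoc a_word)
  (* Expanding one factor x to x * a * x supplies an a = a1 * a2, at which a copy of
     a2 * (x * x) * a1 can be split off. *)
  have "x * x = \<beta> * u * x * (x * a * x)"
    using x\<beta> outer by simp
  also have "\<dots> = \<beta> * (u * x * a) * (x * x)"
    by (simp add: sort_word)
  finally have "a2 * (x * x) * a1 = a2 * (\<beta> * (u * x * a) * (x * x)) * a1"
    by (rule arg_cong)
  also have "\<dots> = a2 * \<beta> * (u * x * a1) * (a2 * (x * x) * a1)"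
    by (simp add: mult.assoc a_word)
  finally have range_left:
    "a2 * (x * x) * a1 = a2 * \<beta> * (u * x * a1) * (a2 * (x * x) * a1)" .
  have "x * x = x * a * x * (x * v * \<gamma>)"
    using x\<gamma> outer by simp
  also have "\<dots> = x * x * a * (x * v) * \<gamma>"
    by (simp add: sort_word)
  finally have "a2 * (x * x) * a1 = a2 * (x * x * a * (x * v) * \<gamma>) * a1"
    by (rule arg_cong)
  also have "\<dots> = a2 * (x * x) * a1 * (a2 * x * v) * (\<gamma> * a1)"
    by (simp add: mult.assoc a_word)
  finally have range_right:
    "a2 * (x * x) * a1 = a2 * (x * x) * a1 * (a2 * x * v) * (\<gamma> * a1)" .
  show ?thesis
    unfolding is_bc_inverse_def
    using absorb_left absorb_right range_left range_right by blast
qed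

lemma mult_S1_right_assoc: "(u * v) \<cdot>\<^sub>r \<mu> = u * (v \<cdot>\<^sub>r \<mu>)"
  by (cases \<mu>) (simp_all add: mult.assoc)

lemma mult_S1_left_assoc: "\<nu> \<cdot>\<^sub>l (u * v) = (\<nu> \<cdot>\<^sub>l u) * v"
  by (cases \<nu>) (simp_all add: mult.assoc)

lemma bc_inverse_swap_S1:
  fixes a1 a2 b c x :: "'a::semigroup_mult"
  assumes inv: "is_bc_inverse (a1 * a2) b c x"
    and p: "(a1 * a2) * b = (b \<cdot>\<^sub>r \<mu>) * p" and q: "c * (a1 * a2) = q * (\<nu> \<cdot>\<^sub>l c)"
  shows "is_bc_inverse (a2 * a1) (a2 * b \<cdot>\<^sub>r \<mu>) (\<nu> \<cdot>\<^sub>l (c * a1)) (a2 * (x * x) * a1)"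
proof -
  have "x * (a1 * a2) * b = b" and "c * (a1 * a2) * x = c"
    using inv by (simp_all add: is_bc_inverse_def)
  then have "x * (a1 * a2) * (b \<cdot>\<^sub>r \<mu>) = b \<cdot>\<^sub>r \<mu>" and "(\<nu> \<cdot>\<^sub>l c) * (a1 * a2) * x = \<nu> \<cdot>\<^sub>l c"
    by (metis mult_S1_right_assoc, metis mult_S1_left_assoc)
  from bc_inverse_swap[OF inv this p q] show ?thesis
    by (simp only: mult_S1_right_assoc mult_S1_left_assoc)
qed

text \<open>
  If \<open>x\<close> commutes with \<open>a = a1 * a2\<close>, then \<open>a * d = x * a * a * d\<close> lies in \<open>d S\<close> because \<open>x\<close> does,
  and \<open>d = d * a * x\<close> lets an \<open>a1\<close> be inserted right after the leading \<open>d\<close>. Dually for \<open>d * a\<close>.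
\<close>

lemma commuting_bc_inverse_ranges:
  fixes a1 a2 d x :: "'a::semigroup_mult"
  assumes inv: "is_bc_inverse (a1 * a2) d d x"
    and comm: "x * (a1 * a2) = (a1 * a2) * x"
  shows "\<exists>p. (a1 * a2) * d = d * a1 * p" and "\<exists>q. d * (a1 * a2) = q * (a2 * d)"
proof -
  define a where "a = a1 * a2"
  obtain s where s: "x = d * s * x" using inv by (auto simp: is_bc_inverse_def)
  obtain t where t: "x = x * t * d" using inv by (auto simp: is_bc_inverse_def)
  have l: "x * a * d = d" and r: "d * a * x = d" and comm: "x * a = a * x"
    using inv comm by (simp_all add: is_bc_inverse_def a_def)
  have comm_left: "x * (a * z) = a * (x * z)" for z
    by (simp only: mult.assoc[symmetric] comm)
  note sort_word = mult.assoc comm comm_left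
  have "a * d = a * (x * a * d)"
    by (simp only: l)
  also have "\<dots> = x * (a * a * d)"
    by (simp add: sort_word)
  also have "x = d * a * x * s * x"
    by (simp only: r s[symmetric])
  finally have "(a1 * a2) * d = d * a1 * (a2 * x * s * x * (a * a * d))"
    unfolding a_def mult.assoc .
  then show "\<exists>p. (a1 * a2) * d = d * a1 * p" ..
  have "d * a = d * a * x * a"
    by (simp only: r)
  also have "\<dots> = d * a * a * x"
    by (simp add: sort_word)
  also have "x = x * t * (x * a * d)"
    by (simp only: l t[symmetric])
  finally have "d * (a1 * a2) = d * a * a * x * t * x * a1 * (a2 * d)"
    unfolding a_def mult.assoc .
  then show "\<exists>q. d * (a1 * a2) = q * (a2 * d)" ..
qed

theorem theorem5p4:
  fixes a1 a2 b c x :: "'a::semigroup_mult"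
  assumes "is_bc_inverse (a1 * a2) b c x"
  shows "(\<forall>\<mu>\<in>S1. \<forall>\<nu>\<in>S1.
            (a1 * a2) * b \<in> {(b \<cdot>\<^sub>r \<mu>) * s | s. True} \<longrightarrow>
            c * (a1 * a2) \<in> {s * (\<nu> \<cdot>\<^sub>l c) | s. True} \<longrightarrow>
              bc_invertible (a2 * a1) (a2 * b \<cdot>\<^sub>r \<mu>) (\<nu> \<cdot>\<^sub>l (c * a1)) \<and>
              is_bc_inverse (a2 * a1) (a2 * b \<cdot>\<^sub>r \<mu>) (\<nu> \<cdot>\<^sub>l (c * a1)) (a2 * (x * x) * a1))
       \<and> (\<forall>d. x * (a1 * a2) = (a1 * a2) * x \<longrightarrow> b = d \<longrightarrow> c = d \<longrightarrow>
              bc_invertible (a2 * a1) (a2 * d * a1) (a2 * d * a1) \<and>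
              is_bc_inverse (a2 * a1) (a2 * d * a1) (a2 * d * a1) (a2 * (x * x) * a1))"
proof (intro conjI ballI allI impI)
  fix \<mu> \<nu> :: "'a option"
  assume "(a1 * a2) * b \<in> {(b \<cdot>\<^sub>r \<mu>) * s | s. True}"
    and "c * (a1 * a2) \<in> {s * (\<nu> \<cdot>\<^sub>l c) | s. True}"
  then show "is_bc_inverse (a2 * a1) (a2 * b \<cdot>\<^sub>r \<mu>) (\<nu> \<cdot>\<^sub>l (c * a1)) (a2 * (x * x) * a1)"
    using bc_inverse_swap_S1[OF assms] by blast
  then show "bc_invertible (a2 * a1) (a2 * b \<cdot>\<^sub>r \<mu>) (\<nu> \<cdot>\<^sub>l (c * a1))"
    unfolding bc_invertible_def ..
next
  fix d
  assume comm: "x * (a1 * a2) = (a1 * a2) * x" and "b = d" and "c = d"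
  then have inv: "is_bc_inverse (a1 * a2) d d x"
    using assms by simp
  obtain p where p: "(a1 * a2) * d = (d \<cdot>\<^sub>r Some a1) * p"
    using commuting_bc_inverse_ranges(1)[OF inv comm] by auto
  obtain q where q: "d * (a1 * a2) = q * (Some a2 \<cdot>\<^sub>l d)"
    using commuting_bc_inverse_ranges(2)[OF inv comm] by auto
  from bc_inverse_swap_S1[OF inv p q]
  show "is_bc_inverse (a2 * a1) (a2 * d * a1) (a2 * d * a1) (a2 * (x * x) * a1)"
    by (simp add: mult.assoc)
  then show "bc_invertible (a2 * a1) (a2 * d * a1) (a2 * d * a1)"
    unfolding bc_invertible_def ..
qed

end
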